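(* Let $E$ be a real Banach space that is a local-GL-space. Then $E$ has the Mazur-Ulam property: for every real Banach space $F$ and every surjective isometry $T:S_E\to S_F$, there is a linear isometry $\widetilde T$ from $E$ onto $F$ with $\widetilde T|_{S_E}=T$.
   Context: All spaces are over the real field. $B_E$, $S_E$, $E^*$ denote the closed unit ball, the unit sphere and the dual of $E$. An isometry is a distance-preserving map. A Banach space $E$ is a GL-space (generalized-lush space) if for every $x\in S_E$ and every $\varepsilon>0$ there is $x^*\in S_{E^*}$ such that, with $S=S(x^*,\varepsilon)=\{z\in B_E: x^*(z)>1-\varepsilon\}$, one has $x\in S$ and $\mathrm{dist}(y,S)+\mathrm{dist}(y,-S)<2+\varepsilon$ for all $y\in S_E$. A Banach space $E$ is a local-GL-space if for every separable subspace $X\subset E$ there is a (closed) subspace $Y$ of $E$ which is a GL-space (with the inherited norm) and satisfies $X\subset Y\subset E$. *)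

theory Defs
  imports "HOL-Analysis.Analysis"
begin

text \<open>
  Subspaces are sets of vectors of an ambient type, so that one can quantify over them. The
  notions below are intrinsic to such a set: only vectors of the subspace enter. In particular
  the dual of \<open>Y\<close> consists of functionals linear and bounded on \<open>Y\<close>, represented by functions on
  the ambient type whose values outside \<open>Y\<close> are irrelevant.
\<close>

definition banach_carrier :: "'a::real_normed_vector set \<Rightarrow> bool" where
  "banach_carrier Y \<longleftrightarrow> subspace Y \<and> complete Y"

definition unit_ball_of :: "'a::real_normed_vector set \<Rightarrow> 'a set" where
  "unit_ball_of Y = Y \<inter> cball 0 1"

definition unit_sphere_of :: "'a::real_normed_vector set \<Rightarrow> 'a set" where
  "unit_sphere_of Y = Y \<inter> sphere 0 1"

(* The boundedness clause is needed because the real-valued supremum of an unbounded set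
   is unspecified. *)
definition dual_of :: "'a::real_normed_vector set \<Rightarrow> ('a \<Rightarrow> real) set" where
  "dual_of Y = {f. (\<forall>x\<in>Y. \<forall>y\<in>Y. f (x + y) = f x + f y) \<and>
                   (\<forall>c. \<forall>x\<in>Y. f (c *\<^sub>R x) = c * f x) \<and>
                   bdd_above ((\<lambda>x. \<bar>f x\<bar>) ` unit_ball_of Y)}"

definition dual_norm_of :: "'a::real_normed_vector set \<Rightarrow> ('a \<Rightarrow> real) \<Rightarrow> real" where
  "dual_norm_of Y f = (SUP x\<in>unit_ball_of Y. \<bar>f x\<bar>)"

definition dual_sphere_of :: "'a::real_normed_vector set \<Rightarrow> ('a \<Rightarrow> real) set" where
  "dual_sphere_of Y = {f \<in> dual_of Y. dual_norm_of Y f = 1}"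

definition slice_of :: "'a::real_normed_vector set \<Rightarrow> ('a \<Rightarrow> real) \<Rightarrow> real \<Rightarrow> 'a set" where
  "slice_of Y f \<epsilon> = {z \<in> unit_ball_of Y. f z > 1 - \<epsilon>}"

(* infdist is 0 for an empty set, but here the slice contains x. *)
definition GL_space :: "'a::real_normed_vector set \<Rightarrow> bool" where
  "GL_space Y \<longleftrightarrow> banach_carrier Y \<and>
     (\<forall>x\<in>unit_sphere_of Y. \<forall>\<epsilon>>0. \<exists>f\<in>dual_sphere_of Y.
        x \<in> slice_of Y f \<epsilon> \<and>
        (\<forall>y\<in>unit_sphere_of Y.
           infdist y (slice_of Y f \<epsilon>) + infdist y (uminus ` slice_of Y f \<epsilon>) < 2 + \<epsilon>))"

(* X need not be closed. Y is automatically closed, being complete. *)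
definition local_GL_space :: "'a::real_normed_vector set \<Rightarrow> bool" where
  "local_GL_space E \<longleftrightarrow> banach_carrier E \<and>
     (\<forall>X. subspace X \<and> X \<subseteq> E \<and> separable_space (top_of_set X) \<longrightarrow>
        (\<exists>Y. GL_space Y \<and> X \<subseteq> Y \<and> Y \<subseteq> E))"

definition isometry_onto :: "'a::metric_space set \<Rightarrow> 'b::metric_space set \<Rightarrow> ('a \<Rightarrow> 'b) \<Rightarrow> bool" where
  "isometry_onto A B T \<longleftrightarrow> T ` A = B \<and> (\<forall>x\<in>A. \<forall>y\<in>A. dist (T x) (T y) = dist x y)"

end

theory Submission
  imports Defs
begin

text \<open>
  The positively homogeneous extension \<open>V x = \<parallel>x\<parallel> T (x / \<parallel>x\<parallel>)\<close> does not decrease distances.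
  It suffices to compare \<open>x\<close> and \<open>\<lambda> y\<close> for unit vectors \<open>x\<close>, \<open>y\<close> and \<open>0 \<le> \<lambda> \<le> 1\<close>. Take a GL-subspace
  containing \<open>x\<close> and \<open>y\<close> and a functional \<open>f\<close> with the slice \<open>S\<close> given by the GL-property at
  the normalisation of \<open>x - \<lambda> y\<close>. There are \<open>u, v \<in> S\<close> with \<open>\<parallel>x - u\<parallel> \<approx> 1 - f x\<close> and
  \<open>\<parallel>y + v\<parallel> \<approx> 1 + f y\<close>, and \<open>\<parallel>T u - T (- v)\<parallel> = \<parallel>u + v\<parallel> \<approx> 2\<close> yields
  \<open>\<parallel>T x - \<lambda> T y\<parallel> \<ge> f x - \<lambda> f y \<approx> \<parallel>x - \<lambda> y\<parallel>\<close> up to a small error. Hence the inverse of \<open>V\<close> is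
  nonexpansive; being isometric on every sphere centred at 0 it is an isometry, and the
  Mazur-Ulam theorem makes \<open>V\<close> linear.
\<close>

subsection \<open>The Mazur-Ulam theorem\<close>

lemma isometry_fixing_ends_fixes_midpoint:
  fixes a b :: "'a::real_normed_vector"
  assumes "bij g" "\<And>x y. dist (g x) (g y) = dist x y" "g a = a" "g b = b"
  shows "g (midpoint a b) = midpoint a b"
proof -
  define z where "z = midpoint a b"
  \<comment> \<open>The point reflection in \<open>z\<close>: it swaps \<open>a\<close> and
    \<open>b\<close>, and it moves each point by twice the distance from \<open>z\<close>.\<close>
  define \<psi> where "\<psi> x = a + b - x" for x :: 'a
  have \<psi>: "\<psi> (\<psi> x) = x" "dist (\<psi> x) (\<psi> y) = dist x y" "\<psi> a = b" "\<psi> b = a" "\<psi> z = z" for x y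
    by (auto simp: \<psi>_def z_def midpoint_def dist_norm norm_minus_commute algebra_simps
        simp flip: scaleR_add_left)
  have inv\<psi>: "dist w (\<psi> w) = 2 * dist w z" for w
  proof -
    have "w - \<psi> w = 2 *\<^sub>R (w - z)"
      by (simp add: \<psi>_def z_def midpoint_def algebra_simps scaleR_2)
    then show ?thesis by (simp add: dist_norm)
  qed
  \<comment> \<open>Replacing \<open>g\<close> by \<open>\<psi> \<circ> inv g \<circ> \<psi> \<circ> g\<close> doubles the displacement of the midpoint, which is
     bounded independently of \<open>g\<close>.\<close>
  have bound: "2 ^ n * dist (g z) z \<le> 2 * dist a z"
    if "bij g" "\<And>x y. dist (g x) (g y) = dist x y" "g a = a" "g b = b" for n g
    using that
  proof (induction n arbitrary: g)
    case 0
    have "dist (g z) z \<le> dist z a + dist a z"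
      using dist_triangle[of "g z" z a] 0(2)[of z a] 0(3) by simp
    then show ?case by (simp add: dist_commute)
  next
    case (Suc n)
    define h where "h x = \<psi> (inv g (\<psi> (g x)))" for x
    have g: "g (inv g x) = x" "inv g (g x) = x" for x
      using Suc.prems(1) by (simp_all add: bij_is_surj bij_is_inj surj_f_inv_f)
    have invg: "dist (inv g x) (inv g y) = dist x y" for x y
      using Suc.prems(2)[of "inv g x" "inv g y"] g by simp
    have "bij h"
      by (rule o_bij[where g = "\<lambda>x. inv g (\<psi> (g (\<psi> x)))"]) (auto simp: h_def \<psi> g fun_eq_iff)
    moreover have "dist (h x) (h y) = dist x y" for x y
      by (simp add: h_def \<psi> invg Suc.prems(2))
    moreover have "h a = a" "h b = b"
      unfolding h_def using \<psi> g Suc.prems(3,4) by metis+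
    ultimately have "2 ^ n * dist (h z) z \<le> 2 * dist a z"
      by (rule Suc.IH)
    also have "dist (h z) z = dist (\<psi> (h z)) (\<psi> z)"
      by (simp only: \<psi>(2))
    also have "\<dots> = dist (g (inv g (\<psi> (g z)))) (g z)"
      by (simp only: h_def \<psi>(1,5) Suc.prems(2))
    also have "\<dots> = 2 * dist (g z) z"
      by (simp add: g inv\<psi> dist_commute)
    finally show ?case by simp
  qed
  have "dist (g z) z = 0"
  proof (rule ccontr)
    assume "dist (g z) z \<noteq> 0"
    then obtain n where "2 * dist a z / dist (g z) z < 2 ^ n"
      using real_arch_pow[of 2 "2 * dist a z / dist (g z) z"] by auto
    then have "2 * dist a z < 2 ^ n * dist (g z) z"
      using \<open>dist (g z) z \<noteq> 0\<close> by (simp add: field_simps)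
    then show False
      using bound[OF assms] by (simp add: not_le[symmetric])
  qed
  then show ?thesis by (simp add: z_def)
qed

text \<open>Conjugating the point reflection that swaps \<open>V a\<close> and \<open>V b\<close>
  back through \<open>V\<close>, then reflecting in the midpoint of \<open>a\<close> and
  \<open>b\<close>, gives a bijective isometry fixing \<open>a\<close> and \<open>b\<close>. By the
  previous lemma it fixes the midpoint, so the image of the midpoint is fixed by the reflection
  downstairs.\<close>

lemma surj_isometry_midpoint:
  fixes V :: "'a::real_normed_vector \<Rightarrow> 'b::real_normed_vector"
  assumes "surj V" and iso: "\<And>x y. dist (V x) (V y) = dist x y"
  shows "V (midpoint a b) = midpoint (V a) (V b)"
proof -
  have "inj V"
    using iso by (metis dist_eq_0_iff injI)
  then have V: "V (inv V p) = p" "inv V (V x) = x" for p x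
    using \<open>surj V\<close> by (simp_all add: surj_f_inv_f)
  have invV: "dist (inv V p) (inv V q) = dist p q" for p q
    using iso[of "inv V p" "inv V q"] V by simp
  define \<psi> where "\<psi> x = a + b - x" for x :: 'a
  define \<rho> where "\<rho> p = V a + V b - p" for p :: 'b
  have \<psi>\<rho>: "\<psi> (\<psi> x) = x" "\<rho> (\<rho> p) = p" "dist (\<psi> x) (\<psi> y) = dist x y" "dist (\<rho> p) (\<rho> q) = dist p q"
    for x y p q
    by (auto simp: \<psi>_def \<rho>_def dist_norm norm_minus_commute)
  define h where "h x = \<psi> (inv V (\<rho> (V x)))" for x
  have "bij h"
    by (rule o_bij[where g = "\<lambda>x. inv V (\<rho> (V (\<psi> x)))"]) (auto simp: h_def \<psi>\<rho> V fun_eq_iff)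
  moreover have "dist (h x) (h y) = dist x y" for x y
    by (simp add: h_def \<psi>\<rho> invV iso)
  moreover have "h a = a" "h b = b"
    by (simp_all add: h_def \<psi>_def \<rho>_def V)
  ultimately have "h (midpoint a b) = midpoint a b"
    by (rule isometry_fixing_ends_fixes_midpoint)
  then have "inv V (\<rho> (V (midpoint a b))) = \<psi> (midpoint a b)"
    unfolding h_def using \<psi>\<rho>(1) by metis
  also have "\<psi> (midpoint a b) = midpoint a b"
    by (simp add: \<psi>_def midpoint_def algebra_simps flip: scaleR_add_left)
  finally have "\<rho> (V (midpoint a b)) = V (midpoint a b)"
    using V by metis
  then have "2 *\<^sub>R V (midpoint a b) = V a + V b"
    by (simp add: \<rho>_def scaleR_2 algebra_simps)
  then show ?thesis
    by (simp add: midpoint_def flip: \<open>2 *\<^sub>R _ = _\<close>)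
qed

text \<open>Homogeneity at 1/2 turns preservation of midpoints into additivity. Additivity makes
  \<open>V\<close> odd, which reduces negative scalars to positive ones.\<close>

lemma linear_pos_homogeneous_isometry:
  fixes V :: "'a::real_normed_vector \<Rightarrow> 'b::real_normed_vector"
  assumes "surj V" and "\<And>x y. dist (V x) (V y) = dist x y"
    and hom: "\<And>c x. c \<ge> 0 \<Longrightarrow> V (c *\<^sub>R x) = c *\<^sub>R V x"
  shows "linear V"
proof
  show add: "V (x + y) = V x + V y" for x y
    using surj_isometry_midpoint[OF assms(1,2), of x y] hom[of "1/2" "x + y"]
    by (simp add: midpoint_def)
  have "V 0 = 0"
    using hom[of 0 0] by simp
  then have minus: "V (- x) = - V x" for x
    using add[of x "- x"] by (simp add: add_eq_0_iff)
  show "V (c *\<^sub>R x) = c *\<^sub>R V x" for c x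
  proof (cases "c \<ge> 0")
    case False
    then show ?thesis using hom[of "- c" "- x"] minus[of x] by simp
  qed (simp add: hom)
qed

subsection \<open>Nonexpansive maps that are isometric on spheres\<close>

lemma ray_meets_sphere:
  fixes a b :: "'a::real_normed_vector"
  assumes "norm b < norm a"
  obtains t where "t \<ge> 1" "norm (a + t *\<^sub>R (b - a)) = norm a"
proof -
  have "b \<noteq> a" using assms by auto
  \<comment> \<open>Large enough that the displacement from \<open>a\<close> has length at least
    \<open>2 * norm a\<close>, so the endpoint lies on or outside the sphere through
    \<open>a\<close>. The summand 1 puts \<open>s\<close> beyond the parameter of
    \<open>b\<close>.\<close>
  define s where "s = 1 + 2 * norm a / norm (b - a)"
  have s: "s * norm (b - a) = norm (b - a) + 2 * norm a" "1 \<le> s"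
    using \<open>b \<noteq> a\<close> by (simp_all add: s_def field_simps)
  have "norm (s *\<^sub>R (b - a)) \<le> norm (a + s *\<^sub>R (b - a)) + norm a"
    using norm_triangle_ineq4[of "a + s *\<^sub>R (b - a)" a] by simp
  then have "norm a \<le> norm (a + s *\<^sub>R (b - a))"
    using s norm_ge_zero[of "b - a"] by (simp only: norm_scaleR)
  moreover have "norm (a + 1 *\<^sub>R (b - a)) \<le> norm a"
    using assms by simp
  moreover have "continuous_on {1..s} (\<lambda>t. norm (a + t *\<^sub>R (b - a)))"
    by (intro continuous_intros)
  ultimately obtain t where "1 \<le> t" "norm (a + t *\<^sub>R (b - a)) = norm a"
    using IVT'[of "\<lambda>t. norm (a + t *\<^sub>R (b - a))" 1 "norm a" s] s by auto
  then show ?thesis using that by blast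
qed

text \<open>Extend the segment from \<open>a\<close> through the shorter vector \<open>b\<close> to
  a point \<open>c\<close> with the norm of \<open>a\<close>. The distances along it add up and
  \<open>W\<close> preserves the total, so neither part can shrink.\<close>

lemma nonexpansive_isometric_on_spheres:
  fixes W :: "'a::real_normed_vector \<Rightarrow> 'b::real_normed_vector"
  assumes le: "\<And>p q. dist (W p) (W q) \<le> dist p q"
    and eq: "\<And>p q. norm p = norm q \<Longrightarrow> dist (W p) (W q) = dist p q"
  shows "dist (W p) (W q) = dist p q"
proof -
  have *: "dist (W a) (W b) = dist a b" if ba: "norm b < norm a" for a b
  proof -
    obtain t where t: "t \<ge> 1" "norm (a + t *\<^sub>R (b - a)) = norm a"
      using ray_meets_sphere[OF ba] .
    define c where "c = a + t *\<^sub>R (b - a)"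
    have "a - c = t *\<^sub>R (a - b)" "b - c = (t - 1) *\<^sub>R (a - b)"
      by (simp_all add: c_def algebra_simps)
    then have "dist a c = dist a b + dist b c"
      unfolding dist_norm using t(1) by (simp only: norm_scaleR) (simp add: left_diff_distrib)
    moreover have "dist (W a) (W c) = dist a c"
      using t by (intro eq) (simp add: c_def)
    ultimately show ?thesis
      using dist_triangle[of "W a" "W c" "W b"] le[of a b] le[of b c] by simp
  qed
  show ?thesis
    using *[of p q] *[of q p] eq[of p q] by (metis dist_commute linorder_neqE)
qed

subsection \<open>GL-spaces\<close>

lemma infdist_less_imp_ex:
  assumes "S \<noteq> {}" "infdist x S < r"
  shows "\<exists>s\<in>S. dist x s < r"
  using assms by (simp add: infdist_notempty cINF_less_iff)

lemma dual_sphere_of_le_norm: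
  assumes "subspace Y" "f \<in> dual_sphere_of Y" "x \<in> Y"
  shows "\<bar>f x\<bar> \<le> norm x"
proof (cases "x = 0")
  case True
  have "f (0 *\<^sub>R x) = 0 * f x"
    using assms unfolding dual_sphere_of_def dual_of_def by blast
  then show ?thesis using True by simp
next
  case False
  have f: "f (c *\<^sub>R x) = c * f x" "bdd_above ((\<lambda>x. \<bar>f x\<bar>) ` unit_ball_of Y)"
    "(SUP x\<in>unit_ball_of Y. \<bar>f x\<bar>) = 1" for c
    using assms by (auto simp: dual_sphere_of_def dual_of_def dual_norm_of_def)
  have "inverse (norm x) *\<^sub>R x \<in> unit_ball_of Y"
    using assms False by (simp add: unit_ball_of_def subspace_scale)
  then have "\<bar>f (inverse (norm x) *\<^sub>R x)\<bar> \<le> 1"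
    using cSUP_upper[OF _ f(2)] f(3) by metis
  then show ?thesis using False by (simp add: f(1) abs_mult field_simps)
qed

text \<open>The slice lies in the ball, while \<open>T\<close> is controlled only on the sphere.
  From 1 - e < f w \<le> norm w it follows that normalising moves \<open>w\<close> by less than
  \<open>e\<close>; since \<open>f w\<close> is positive, it does not lower the value of
  \<open>f\<close>.\<close>

lemma slice_of_normalize:
  assumes "subspace Y" "f \<in> dual_sphere_of Y" "0 < e" "e < 1" "w \<in> slice_of Y f e"
  obtains u where "u \<in> Y" "norm u = 1" "f u > 1 - e" "norm (w - u) < e"
proof -
  have w: "w \<in> Y" "norm w \<le> 1" "f w > 1 - e"
    using assms by (auto simp: slice_of_def unit_ball_of_def)
  have fw: "f w \<le> norm w"
    using dual_sphere_of_le_norm[OF assms(1,2) w(1)] by simp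
  then have "0 < norm w" using w assms by linarith
  show ?thesis
  proof
    show "sgn w \<in> Y" using assms(1) w by (simp add: sgn_div_norm subspace_scale)
    show "norm (sgn w) = 1" using \<open>0 < norm w\<close> by (simp add: norm_sgn)
    have "f (sgn w) = f w / norm w"
      using assms(2) w(1) by (simp add: dual_sphere_of_def dual_of_def sgn_div_norm field_simps)
    moreover have "f w \<le> f w / norm w"
      using w assms \<open>0 < norm w\<close> by (simp add: pos_le_divide_eq mult_left_le)
    ultimately show "f (sgn w) > 1 - e" using w by linarith
    have "w - sgn w = (1 - 1 / norm w) *\<^sub>R w"
      by (simp add: sgn_div_norm algebra_simps divide_inverse)
    then have "norm (w - sgn w) = \<bar>(1 - 1 / norm w) * norm w\<bar>"
      by (simp only: norm_scaleR abs_mult abs_norm_cancel)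
    also have "(1 - 1 / norm w) * norm w = norm w - 1"
      using \<open>0 < norm w\<close> by (simp add: left_diff_distrib)
    finally show "norm (w - sgn w) < e" using w fw by linarith
  qed
qed

text \<open>After normalisation the two distances sum to less than 2 + 3e. As \<open>f\<close> has
  norm 1, they exceed 1 - f y - e and 1 + f y - e respectively, so each lower bound yields an upper
  bound for the other distance.\<close>

lemma GL_space_functional:
  assumes "GL_space Y" "z \<in> Y" "norm z = 1" "0 < e" "e < 1"
  shows "\<exists>f\<in>dual_sphere_of Y. f z > 1 - e \<and>
    (\<forall>y\<in>Y. norm y = 1 \<longrightarrow> (\<exists>u\<in>Y. \<exists>v\<in>Y.
      norm u = 1 \<and> f u > 1 - e \<and> norm (y - u) < 1 - f y + 4 * e \<and>
      norm v = 1 \<and> f v > 1 - e \<and> norm (y + v) < 1 + f y + 4 * e))"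
proof -
  have Y: "subspace Y" using assms(1) by (simp add: GL_space_def banach_carrier_def)
  obtain f where f: "f \<in> dual_sphere_of Y" "z \<in> slice_of Y f e"
    and inf: "\<And>y. y \<in> unit_sphere_of Y \<Longrightarrow>
      infdist y (slice_of Y f e) + infdist y (uminus ` slice_of Y f e) < 2 + e"
    using assms unfolding GL_space_def unit_sphere_of_def by force
  have add: "f (x + y) = f x + f y" if "x \<in> Y" "y \<in> Y" for x y
    using f that by (simp add: dual_sphere_of_def dual_of_def)
  have diff: "f (x - y) = f x - f y" if "x \<in> Y" "y \<in> Y" for x y
    using add[of "x - y" y] that Y by (simp add: subspace_diff)
  note le = dual_sphere_of_le_norm[OF Y f(1)]
  have uv: "\<exists>u\<in>Y. \<exists>v\<in>Y. norm u = 1 \<and> f u > 1 - e \<and> norm (y - u) < 1 - f y + 4 * e \<and>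
      norm v = 1 \<and> f v > 1 - e \<and> norm (y + v) < 1 + f y + 4 * e"
    if y: "y \<in> Y" "norm y = 1" for y
  proof -
    let ?S = "slice_of Y f e"
    \<comment> \<open>Half the slack in the GL-inequality, to be spent once on each nearly nearest
      point.\<close>
    define r where "r = (2 + e - infdist y ?S - infdist y (uminus ` ?S)) / 2"
    have "r > 0" using inf[of y] y by (simp add: unit_sphere_of_def r_def)
    then obtain u0 v0 where u0: "u0 \<in> ?S" "dist y u0 < infdist y ?S + r"
      and v0: "v0 \<in> ?S" "dist y (- v0) < infdist y (uminus ` ?S) + r"
      using infdist_less_imp_ex[of ?S y "infdist y ?S + r"]
        infdist_less_imp_ex[of "uminus ` ?S" y "infdist y (uminus ` ?S) + r"] f(2) by auto
    have "norm (y - u0) + norm (y + v0) < 2 + e"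
      using u0 v0 by (simp add: dist_norm r_def field_simps)
    moreover obtain u where u: "u \<in> Y" "norm u = 1" "f u > 1 - e" "norm (u0 - u) < e"
      using slice_of_normalize[OF Y f(1) assms(4,5) u0(1)] .
    moreover obtain v where v: "v \<in> Y" "norm v = 1" "f v > 1 - e" "norm (v0 - v) < e"
      using slice_of_normalize[OF Y f(1) assms(4,5) v0(1)] .
    moreover have "norm (y - u) \<le> norm (y - u0) + norm (u0 - u)"
      using norm_triangle_ineq[of "y - u0" "u0 - u"] by simp
    moreover have "norm (y + v) \<le> norm (y + v0) + norm (v0 - v)"
      using norm_triangle_ineq4[of "y + v0" "v0 - v"] by simp
    moreover have "f u - f y \<le> norm (y - u)"
      using le[of "y - u"] y u Y diff[of y u] by (simp add: subspace_diff)
    moreover have "f y + f v \<le> norm (y + v)"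
      using le[of "y + v"] y v Y add[of y v] by (simp add: subspace_add)
    ultimately show ?thesis by (intro bexI[of _ u] bexI[of _ v]) auto
  qed
  have fz: "f z > 1 - e" using f(2) by (simp add: slice_of_def)
  show ?thesis
    by (intro bexI[of _ f] conjI ballI impI uv fz f(1))
qed

lemma GL_space_sphere_isometry_ge:
  fixes T :: "'a::real_normed_vector \<Rightarrow> 'b::real_normed_vector"
  assumes "GL_space Y" "x \<in> Y" "y \<in> Y" "norm x = 1" "norm y = 1" "0 \<le> l" "l \<le> 1"
    and T: "\<And>u v. norm u = 1 \<Longrightarrow> norm v = 1 \<Longrightarrow> dist (T u) (T v) = dist u v"
    and T1: "\<And>u. norm u = 1 \<Longrightarrow> norm (T u) = 1"
  shows "norm (x - l *\<^sub>R y) \<le> norm (T x - l *\<^sub>R T y)"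
proof (cases "x - l *\<^sub>R y = 0")
  case False
  define n where "n = norm (x - l *\<^sub>R y)"
  have Y: "subspace Y" using assms(1) by (simp add: GL_space_def banach_carrier_def)
  have n: "0 < n" "n \<le> 2"
    using False norm_triangle_ineq4[of x "l *\<^sub>R y"] assms by (auto simp: n_def)
  define z where "z = (1 / n) *\<^sub>R (x - l *\<^sub>R y)"
  have z: "z \<in> Y" "norm z = 1"
    using Y assms n by (auto simp: z_def n_def subspace_diff subspace_scale)
  \<comment> \<open>The 12 is 10 + 2: 2e is lost in the norm of \<open>u + v\<close>, 4e in each of
    the approximations of \<open>x\<close> and \<open>y\<close>, and \<open>n * e\<close>, at most
    2e, in \<open>f z > 1 - e\<close>.\<close>
  have approx: "n \<le> norm (T x - l *\<^sub>R T y) + 12 * e" if e: "0 < e" "e < 1" for e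
  proof -
    obtain f where f: "f \<in> dual_sphere_of Y" "f z > 1 - e"
      and ex: "\<forall>y\<in>Y. norm y = 1 \<longrightarrow>
        (\<exists>u\<in>Y. \<exists>v\<in>Y. norm u = 1 \<and> f u > 1 - e \<and> norm (y - u) < 1 - f y + 4 * e \<and>
          norm v = 1 \<and> f v > 1 - e \<and> norm (y + v) < 1 + f y + 4 * e)"
      using GL_space_functional[OF assms(1) z e] by blast
    obtain u where u: "u \<in> Y" "norm u = 1" "f u > 1 - e" "norm (x - u) < 1 - f x + 4 * e"
      using ex assms by blast
    obtain v where v: "v \<in> Y" "norm v = 1" "f v > 1 - e" "norm (y + v) < 1 + f y + 4 * e"
      using ex assms by blast
    have add: "f (x + y) = f x + f y" and scale: "f (c *\<^sub>R x) = c * f x"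
      if "x \<in> Y" "y \<in> Y" for x y c
      using f that by (simp_all add: dual_sphere_of_def dual_of_def)
    define p q where "p = T u" and "q = T (- v)"
    have "2 - 2 * e < f u + f v" using u v by simp
    also have "\<dots> \<le> norm (u + v)"
      using dual_sphere_of_le_norm[OF Y f(1), of "u + v"] add u v Y by (simp add: subspace_add)
    also have "\<dots> = norm (p - q)"
      using T[of u "- v"] u v by (simp add: dist_norm p_def q_def)
    \<comment> \<open>Since \<open>q\<close> is a unit vector, shrinking it by the factor
      \<open>l\<close> costs exactly 1 - l.\<close>
    also have "\<dots> \<le> norm (p - l *\<^sub>R q) + (1 - l)"
    proof -
      have "norm (p - q) \<le> norm (p - l *\<^sub>R q) + norm ((1 - l) *\<^sub>R q)"
        using norm_triangle_ineq4[of "p - l *\<^sub>R q" "(1 - l) *\<^sub>R q"] by (simp add: algebra_simps)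
      moreover have "norm ((1 - l) *\<^sub>R q) = 1 - l"
        using T1[of "- v"] v assms(7) by (simp add: q_def)
      ultimately show ?thesis by simp
    qed
    finally have pq: "1 + l - 2 * e < norm (p - l *\<^sub>R q)" by simp
    have eq: "p - l *\<^sub>R q = (T x - l *\<^sub>R T y) - (T x - p) + l *\<^sub>R (T y - q)"
      by (simp add: algebra_simps)
    have "norm (p - l *\<^sub>R q) \<le> norm (T x - l *\<^sub>R T y) + norm (T x - p) + norm (l *\<^sub>R (T y - q))"
      unfolding eq using norm_triangle_ineq[of "(T x - l *\<^sub>R T y) - (T x - p)" "l *\<^sub>R (T y - q)"]
        norm_triangle_ineq4[of "T x - l *\<^sub>R T y" "T x - p"] by linarith
    moreover have "norm (T x - p) < 1 - f x + 4 * e"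
      using T[of x u] u assms by (simp add: dist_norm p_def)
    moreover have "norm (l *\<^sub>R (T y - q)) \<le> l * (1 + f y + 4 * e)"
      using T[of y "- v"] v assms by (simp add: dist_norm q_def mult_left_mono)
    moreover have "l * (1 + f y + 4 * e) = l + l * f y + 4 * (l * e)" by (simp add: algebra_simps)
    moreover have "l * e \<le> e" using assms e by (simp add: mult_left_le_one_le)
    ultimately have "f x - l * f y \<le> norm (T x - l *\<^sub>R T y) + 10 * e"
      using pq by linarith
    moreover have "f z = (f x - l * f y) / n"
    proof -
      have "z = (1 / n) *\<^sub>R x + (- l / n) *\<^sub>R y" by (simp add: z_def algebra_simps)
      then show ?thesis
        using assms(2,3) Y add[of "(1 / n) *\<^sub>R x" "(- l / n) *\<^sub>R y"]
        by (simp add: scale[of _ x] scale[of _ y] subspace_scale diff_divide_distrib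
            del: scaleR_minus_left)
    qed
    then have "n * (1 - e) \<le> f x - l * f y"
      using f(2) n mult_left_mono[of "1 - e" "f z" n] by simp
    moreover have "n * e \<le> 2 * e" using n e by simp
    ultimately show ?thesis by (simp add: algebra_simps)
  qed
  have "n \<le> norm (T x - l *\<^sub>R T y) + d" if "0 < d" for d
    using approx[of "min (1/2) (d / 12)"] that by (cases "d \<ge> 6") simp_all
  then show ?thesis unfolding n_def by (rule field_le_epsilon)
qed simp

text \<open>The estimate involves two vectors at a time, so the local GL-property is only applied to
  their span, a continuous image of the separable plane.\<close>

lemma separable_space_span_pair:
  fixes x y :: "'a::real_normed_vector"
  shows "separable_space (top_of_set (span {x, y}))"
proof (rule separable_space_continuous_map_image)
  obtain D :: "(real \<times> real) set" where D: "countable D"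
    "\<And>X. open X \<Longrightarrow> X \<noteq> {} \<Longrightarrow> \<exists>d\<in>D. d \<in> X"
    using countable_dense_setE by blast
  have "closure D = UNIV"
    using D(2)[of "- closure D"] closure_subset[of D] by auto
  then show "separable_space (euclidean :: (real \<times> real) topology)"
    using D(1) by (auto simp: separable_space_def)
  have span: "z \<in> span {x, y} \<longleftrightarrow> (\<exists>s t. z = s *\<^sub>R x + t *\<^sub>R y)" for z
    unfolding span_breakdown_eq[of z x] span_singleton image_iff by (simp add: diff_eq_eq add.commute)
  show "continuous_map euclidean (top_of_set (span {x, y})) (\<lambda>p. fst p *\<^sub>R x + snd p *\<^sub>R y)"
    by (auto simp: continuous_map_in_subtopology span intro!: continuous_intros) blast
  show "(\<lambda>p. fst p *\<^sub>R x + snd p *\<^sub>R y) ` topspace euclidean = topspace (top_of_set (span {x, y}))"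
    by (auto simp: image_iff span) blast
qed

lemma local_GL_space_sphere_isometry_ge:
  fixes T :: "'a::real_normed_vector \<Rightarrow> 'b::real_normed_vector"
  assumes "local_GL_space (UNIV :: 'a set)" "norm x = 1" "norm y = 1" "0 \<le> l" "l \<le> 1"
    and T: "\<And>u v. norm u = 1 \<Longrightarrow> norm v = 1 \<Longrightarrow> dist (T u) (T v) = dist u v"
    and T1: "\<And>u. norm u = 1 \<Longrightarrow> norm (T u) = 1"
  shows "norm (x - l *\<^sub>R y) \<le> norm (T x - l *\<^sub>R T y)"
proof -
  obtain Y where "GL_space Y" "span {x, y} \<subseteq> Y"
    using assms(1) separable_space_span_pair unfolding local_GL_space_def
    by (metis subset_UNIV subspace_span)
  moreover have "x \<in> Y" "y \<in> Y" using calculation by (auto intro: span_base)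
  ultimately show ?thesis
    using GL_space_sphere_isometry_ge[of Y x y l T] assms by blast
qed

theorem theorem3p7:
  fixes T :: "'a::banach \<Rightarrow> 'b::banach"
  assumes "local_GL_space (UNIV :: 'a set)"
    and "isometry_onto (sphere 0 1) (sphere 0 1) T"
  shows "\<exists>U :: 'a \<Rightarrow> 'b. linear U \<and> isometry_onto UNIV UNIV U \<and> (\<forall>x\<in>sphere 0 1. U x = T x)"
proof -
  have T: "dist (T u) (T v) = dist u v" if "norm u = 1" "norm v = 1" for u v
    using assms(2) that by (simp add: isometry_onto_def)
  have T1: "norm (T u) = 1" if "norm u = 1" for u
    using assms(2) that by (force simp: isometry_onto_def)
  have Tsurj: "\<exists>u. norm u = 1 \<and> T u = p" if "norm p = 1" for p
  proof -
    have "p \<in> T ` sphere 0 1" using assms(2) that by (simp add: isometry_onto_def)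
    then show ?thesis by auto
  qed
  \<comment> \<open>As \<open>sgn 0 = 0\<close>, the unknown value \<open>T 0\<close> appears at the
    origin, where the factor \<open>norm x\<close> kills it.\<close>
  define V where "V x = norm x *\<^sub>R T (sgn x)" for x
  have normV: "norm (V x) = norm x" for x
    by (cases "x = 0") (simp_all add: V_def T1 norm_sgn)
  have hom: "V (c *\<^sub>R x) = c *\<^sub>R V x" if "c \<ge> 0" for c x
    using that by (cases "c = 0") (simp_all add: V_def sgn_scaleR)
  have VT: "V u = T u" if "norm u = 1" for u
    using that by (simp add: V_def sgn_div_norm)
  have "\<exists>x. V x = p" for p
  proof (cases "p = 0")
    case True
    then show ?thesis by (intro exI[of _ 0]) (simp add: V_def)
  next
    case False
    then obtain u where u: "norm u = 1" "T u = sgn p"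
      using Tsurj[of "sgn p"] by (auto simp: norm_sgn)
    have "V (norm p *\<^sub>R u) = p" using u False by (simp add: hom VT sgn_div_norm)
    then show ?thesis by blast
  qed
  then have "surj V" by (metis surj_def)
  \<comment> \<open>Ordering the norms makes the ratio \<open>l\<close> at most 1; the general case
    follows by symmetry.\<close>
  have ge: "dist x y \<le> dist (V x) (V y)" if "norm y \<le> norm x" for x y
  proof (cases "y = 0")
    case True
    then show ?thesis using normV[of x] normV[of 0] by (simp add: dist_norm)
  next
    case False
    then have pos: "0 < norm x" "0 < norm y" using that by auto
    define l where "l = norm y / norm x"
    have "x - y = norm x *\<^sub>R (sgn x - l *\<^sub>R sgn y)" "V x - V y = norm x *\<^sub>R (T (sgn x) - l *\<^sub>R T (sgn y))"
      using pos by (simp_all add: l_def V_def sgn_div_norm algebra_simps)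
    moreover have "norm (sgn x - l *\<^sub>R sgn y) \<le> norm (T (sgn x) - l *\<^sub>R T (sgn y))"
      using pos that by (intro local_GL_space_sphere_isometry_ge assms(1) T T1) (auto simp: l_def norm_sgn)
    ultimately show ?thesis by (simp add: dist_norm mult_left_mono)
  qed
  have ge: "dist x y \<le> dist (V x) (V y)" for x y
    using ge[of x y] ge[of y x] by (metis dist_commute linear)
  have V_sphere: "dist (V x) (V y) = dist x y" if "norm x = norm y" for x y
  proof (cases "x = 0")
    case True
    then show ?thesis using that by simp
  next
    case False
    have "y \<noteq> 0" using that False by auto
    then have "x - y = norm x *\<^sub>R (sgn x - sgn y)" "V x - V y = norm x *\<^sub>R (T (sgn x) - T (sgn y))"
      using that False by (simp_all add: V_def sgn_div_norm algebra_simps)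
    moreover have "dist (T (sgn x)) (T (sgn y)) = dist (sgn x) (sgn y)"
      using False that by (intro T) (auto simp: norm_sgn)
    ultimately show ?thesis by (simp add: dist_norm)
  qed
  have VinvV: "V (inv V p) = p" for p
    using \<open>surj V\<close> by (simp add: surj_f_inv_f)
  \<comment> \<open>The lemma is applied to \<open>inv V\<close>, because \<open>V\<close> is known
    to be expanding. As \<open>V\<close> preserves norms, points of equal norm have preimages of
    equal norm.\<close>
  have "dist (inv V p) (inv V q) = dist p q" for p q
  proof (rule nonexpansive_isometric_on_spheres)
    show "dist (inv V p) (inv V q) \<le> dist p q" for p q
      using ge[of "inv V p" "inv V q"] by (simp add: VinvV)
    show "dist (inv V p) (inv V q) = dist p q" if "norm p = norm q" for p q
      using V_sphere[of "inv V p" "inv V q"] normV that by (metis VinvV)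
  qed
  moreover have "inj V"
    using ge by (metis dist_self dist_le_zero_iff injI)
  ultimately have iso: "dist (V x) (V y) = dist x y" for x y
    by (metis inv_f_f)
  have "linear V"
    using \<open>surj V\<close> iso hom by (rule linear_pos_homogeneous_isometry)
  then show ?thesis
    using \<open>surj V\<close> iso VT by (intro exI[of _ V]) (auto simp: isometry_onto_def)
qed

end
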